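(* Let $\varphi:[0,\infty]\to[0,\infty]$ be a monotone increasing function with $\lim_{t\to0^+}\varphi(t)=0$, and let $\mathcal{H}^\varphi_\infty$ be the dyadic content associated to $\varphi$. For every $f\in L^1(\mathbb{R}^n;\mathcal{H}^\varphi_\infty)$ one has $$\lim_{r\to0}\frac{1}{\mathcal{H}^\varphi_\infty(B(x,r))}\int_{B(x,r)}|f-f(x)|\,d\mathcal{H}^\varphi_\infty=0$$ for $\mathcal{H}^\varphi_\infty$-quasi every $x\in\mathbb{R}^n$.
   Context: Dyadic cubes. Fix a half-open cube $Q=[x_1,x_1+\ell)\times\cdots\times[x_n,x_n+\ell)\subset\mathbb{R}^n$, $\ell>0$, and put $x_Q=(x_1,\dots,x_n)$. Let $\mathcal{D}_0(Q)=\{x_Q+2^k\ell(m+[0,1)^n): k\in\mathbb{Z}, m\in\mathbb{Z}^n\}$ and $\mathcal{D}(Q)=\mathcal{D}_0(Q)\cup\{\prod_{i=1}^n I_i: I_i=[x_i,\infty)\text{ or }(-\infty,x_i)\}$. Elements of $\mathcal{D}(Q)$ are called dyadic cubes; $l(Q')\in(0,\infty]$ denotes the side length of $Q'$. Dyadic content. $\mathcal{H}^\varphi_\infty(E)=\inf\{\sum_i\varphi(l(Q_i)): E\subset\bigcup_iQ_i,\ Q_i\in\mathcal{D}(Q)\}$ (countable covers). "Monotone increasing" means non-decreasing. Choquet integral. $\int_A f\,dH=\int_0^\infty H(\{x\in A: f(x)>t\})\,dt$ for $f\ge0$. Convention $0\cdot\infty=0$, and an average over a set of zero content is $0$. $L^1(\mathbb{R}^n;H)$.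 A function $f:\mathbb{R}^n\to\mathbb{R}$ is $H$-quasicontinuous if for every $\epsilon>0$ there is an open set $O_\epsilon$ with $H(O_\epsilon)<\epsilon$ and $f|_{O_\epsilon^c}$ continuous. $L^1(\mathbb{R}^n;H)$ is the set of $H$-quasicontinuous $f$ with $\int_{\mathbb{R}^n}|f|\,dH<\infty$ (equivalently, the closure of the bounded continuous functions of finite norm with respect to this norm). "For $H$-quasi every $x$" means: for all $x$ outside some set $E$ with $H(E)=0$. $B(x,r)$ is the open ball. *)

theory Defs
  imports "HOL-Analysis.Analysis"
begin

text \<open>
  The half-open cube \<open>Q\<close> generating the dyadic lattice is represented by its lower corner \<open>a\<close>
  and its side length \<open>l\<close> (with \<open>l > 0\<close>), and \<open>\<real>\<^sup>n\<close> by \<open>real ^ 'n\<close>.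
\<close>

definition dyadic_box :: "real ^ 'n \<Rightarrow> real \<Rightarrow> int \<Rightarrow> int ^ 'n \<Rightarrow> (real ^ 'n) set" where
  "dyadic_box a l k m =
     {x. \<forall>i. a $ i + 2 powi k * l * of_int (m $ i) \<le> x $ i \<and>
             x $ i < a $ i + 2 powi k * l * (of_int (m $ i) + 1)}"

definition dyadic_orthant :: "real ^ 'n \<Rightarrow> 'n set \<Rightarrow> (real ^ 'n) set" where
  "dyadic_orthant a S = {x. \<forall>i. if i \<in> S then a $ i \<le> x $ i else x $ i < a $ i}"

definition dyadic_cubes :: "real ^ 'n \<Rightarrow> real \<Rightarrow> (real ^ 'n) set set" where
  "dyadic_cubes a l = {dyadic_box a l k m |k m. True} \<union> {dyadic_orthant a S |S. True}"

text \<open>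
  The side length is defined for arbitrary sets, as the diameter in the maximum norm; the lemmas
  below show that on \<open>dyadic_cubes a l\<close> it is the usual side length.
\<close>

definition side_length :: "(real ^ 'n) set \<Rightarrow> ennreal" where
  "side_length A = (SUP x\<in>A. SUP y\<in>A. SUP i. ennreal \<bar>x $ i - y $ i\<bar>)"

lemma side_length_upper:
  "x \<in> A \<Longrightarrow> y \<in> A \<Longrightarrow> ennreal \<bar>x $ i - y $ i\<bar> \<le> side_length A"
  unfolding side_length_def by (meson SUP_upper SUP_upper2 UNIV_I order_refl)

lemma side_length_dyadic_box:
  fixes a :: "real ^ 'n"
  assumes "l > 0"
  shows "side_length (dyadic_box a l k m) = ennreal (2 powi k * l)"
proof (rule antisym)
  define s where "s = 2 powi k * l"
  have s: "s > 0" using assms by (simp add: s_def)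
  have "\<bar>x $ i - y $ i\<bar> \<le> s"
    if "x \<in> dyadic_box a l k m" "y \<in> dyadic_box a l k m" for x y :: "real ^ 'n" and i
  proof -
    have "a $ i + s * of_int (m $ i) \<le> x $ i" "x $ i < a $ i + s * (of_int (m $ i) + 1)"
         "a $ i + s * of_int (m $ i) \<le> y $ i" "y $ i < a $ i + s * (of_int (m $ i) + 1)"
      using that unfolding dyadic_box_def s_def by auto
    then show ?thesis by (simp add: algebra_simps abs_if)
  qed
  then show "side_length (dyadic_box a l k m) \<le> ennreal (2 powi k * l)"
    unfolding side_length_def s_def by (intro SUP_least ennreal_leI) auto
  show "ennreal (2 powi k * l) \<le> side_length (dyadic_box a l k m)"
    unfolding s_def[symmetric]
  proof (rule ennreal_le_epsilon)
    fix e :: real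
    assume e: "e > 0"
    define d where "d = max 0 (s - e)"
    have d: "0 \<le> d" "d < s" "s \<le> d + e" using s e by (auto simp: d_def)
    define x where "x = (\<chi> i. a $ i + s * of_int (m $ i))"
    define y where "y = (\<chi> i. a $ i + s * of_int (m $ i) + d)"
    have "x \<in> dyadic_box a l k m" "y \<in> dyadic_box a l k m"
      using d s unfolding dyadic_box_def s_def[symmetric] x_def y_def
      by (auto simp: algebra_simps)
    then have "ennreal \<bar>y $ undefined - x $ undefined\<bar> \<le> side_length (dyadic_box a l k m)"
      by (intro side_length_upper)
    then have "ennreal d \<le> side_length (dyadic_box a l k m)"
      using d by (simp add: x_def y_def)
    moreover have "ennreal s \<le> ennreal d + ennreal e"
      using d e by (metis ennreal_leI ennreal_plus less_imp_le)
    ultimately show "ennreal s \<le> side_length (dyadic_box a l k m) + ennreal e"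
      by (meson add_right_mono order_trans)
  qed
qed

lemma side_length_dyadic_orthant:
  fixes a :: "real ^ 'n"
  shows "side_length (dyadic_orthant a S) = \<infinity>"
proof -
  have "of_nat N \<le> side_length (dyadic_orthant a S)" for N
  proof -
    define x where "x = (\<chi> i. a $ i + (if i \<in> S then 0 else - 1))"
    define y where "y = (\<chi> i. a $ i + (if i \<in> S then real N else - 1 - real N))"
    have "x \<in> dyadic_orthant a S" "y \<in> dyadic_orthant a S"
      unfolding dyadic_orthant_def x_def y_def by auto
    then have "ennreal \<bar>y $ undefined - x $ undefined\<bar> \<le> side_length (dyadic_orthant a S)"
      by (intro side_length_upper)
    moreover have "\<bar>y $ undefined - x $ undefined\<bar> = real N"
      by (simp add: x_def y_def)
    ultimately show ?thesis by (simp add: ennreal_of_nat_eq_real_of_nat)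
  qed
  then have "(SUP N. of_nat N :: ennreal) \<le> side_length (dyadic_orthant a S)"
    by (intro SUP_least)
  then show ?thesis by (simp add: ennreal_SUP_of_nat_eq_top top_unique)
qed

definition dyadic_content ::
    "real ^ 'n \<Rightarrow> real \<Rightarrow> (ennreal \<Rightarrow> ennreal) \<Rightarrow> (real ^ 'n) set \<Rightarrow> ennreal" where
  "dyadic_content a l \<phi> E =
     Inf {(\<Sum>\<^sub>\<infinity>Q\<in>C. \<phi> (side_length Q)) |C.
            countable C \<and> C \<subseteq> dyadic_cubes a l \<and> E \<subseteq> \<Union>C}"

text \<open>Only meaningful for functions that are nonnegative on \<open>A\<close>.\<close>

definition choquet_integral :: "('a set \<Rightarrow> ennreal) \<Rightarrow> 'a set \<Rightarrow> ('a \<Rightarrow> real) \<Rightarrow> ennreal" where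
  "choquet_integral H A f = (\<integral>\<^sup>+t\<in>{0..}. H {x \<in> A. f x > t} \<partial>lborel)"

definition choquet_average :: "('a set \<Rightarrow> ennreal) \<Rightarrow> 'a set \<Rightarrow> ('a \<Rightarrow> real) \<Rightarrow> ennreal" where
  "choquet_average H A f = (if H A = 0 then 0 else choquet_integral H A f / H A)"

definition quasicontinuous ::
    "('a::topological_space set \<Rightarrow> ennreal) \<Rightarrow> ('a \<Rightarrow> real) \<Rightarrow> bool" where
  "quasicontinuous H f \<longleftrightarrow>
     (\<forall>\<epsilon>::real. \<epsilon> > 0 \<longrightarrow> (\<exists>U. open U \<and> H U < ennreal \<epsilon> \<and> continuous_on (- U) f))"

definition choquet_L1 :: "('a::topological_space set \<Rightarrow> ennreal) \<Rightarrow> ('a \<Rightarrow> real) set" where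
  "choquet_L1 H =
     {f. quasicontinuous H f \<and> choquet_integral H UNIV (\<lambda>x. \<bar>f x\<bar>) < \<infinity>}"

definition quasi_every :: "('a set \<Rightarrow> ennreal) \<Rightarrow> ('a \<Rightarrow> bool) \<Rightarrow> bool" where
  "quasi_every H P \<longleftrightarrow> (\<exists>E. H E = 0 \<and> (\<forall>x. x \<notin> E \<longrightarrow> P x))"

end

theory Submission
  imports Defs
begin

text \<open>
  A dyadic box \<open>Q\<close> of side comparable to \<open>r\<close> and its boundedly many neighbours of the same side
  all have the same content, one of them lies inside \<open>B(x,r)\<close> and together they cover it; so no
  doubling condition on \<open>\<phi>\<close> is needed to pass between balls and boxes.

  For a weak type estimate, replace the Choquet integral by \<open>\<Sum>n. 2\<^sup>n H(A\<^sub>n)\<close> over level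
  sets \<open>A\<^sub>n\<close> and fix a nearly optimal dyadic cover \<open>C\<^sub>n\<close> of each \<open>A\<^sub>n\<close>. A box \<open>Q\<close> with
  \<open>H(Q) < \<Sum>n. 2\<^sup>n H(Q \<inter> A\<^sub>n)\<close> is either contained in some \<open>P \<in> C\<^sub>n\<close>, or satisfies
  \<open>H(Q) \<le> \<Sum>n. 2\<^sup>n \<Sum>{\<phi>(l(P)) | P \<in> C\<^sub>n, P \<subseteq> Q}\<close>; the latter bound is additive over the
  disjoint maximal boxes of this kind. Hence the exceptional set has content at most a constant
  times \<open>\<Sum>n. 2\<^sup>n H(A\<^sub>n)\<close>, and neither strong subadditivity of \<open>H\<close> nor a packing argument enters.

  Given a quasicontinuous \<open>f\<close> and an open \<open>U\<close> of small content off which \<open>f\<close> is continuous, this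
  is applied to the level sets of \<open>\<bar>f\<bar> + M\<close> within \<open>U\<close>, with \<open>M\<close> a bound for \<open>\<bar>f x\<bar>\<close>: the sum
  over these is small because the sum over the level sets of \<open>\<bar>f\<bar>\<close> converges.
\<close>

section \<open>Cost of a cover as a measure; countable subadditivity of the content\<close>

lemma infsum_ennreal_eq_nn_integral:
  fixes f :: "'a \<Rightarrow> ennreal"
  assumes "countable A"
  shows "(\<Sum>\<^sub>\<infinity>x\<in>A. f x) = (\<integral>\<^sup>+x. f x \<partial>count_space A)"
proof (cases "finite A")
  case True
  then show ?thesis by (simp add: nn_integral_count_space_finite)
next
  case False
  then have g: "bij_betw (from_nat_into A) UNIV A"
    using assms by (simp add: bij_betw_from_nat_into)
  have "(\<Sum>\<^sub>\<infinity>x\<in>A. f x) = (\<Sum>\<^sub>\<infinity>i. f (from_nat_into A i))"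
    using infsum_reindex_bij_betw[OF g, of f] by simp
  also have "\<dots> = (\<Sum>i. f (from_nat_into A i))"
    by (intro sums_unique has_sum_imp_sums has_sum_infsum nonneg_summable_on_complete) simp
  also have "\<dots> = (\<integral>\<^sup>+x. f x \<partial>count_space A)"
    using nn_integral_bij_count_space[OF g, of f] by (simp add: nn_integral_count_space_nat)
  finally show ?thesis .
qed

text \<open>Treating the cost of a cover as a measure on families of cubes brings in subadditivity
  and countable additivity over disjoint subfamilies; the weak type estimate rests on the
  latter.\<close>

definition cost_measure :: "(ennreal \<Rightarrow> ennreal) \<Rightarrow> (real ^ 'n) set measure" where
  "cost_measure \<phi> = density (count_space UNIV) (\<lambda>Q. \<phi> (side_length Q))"

lemma sets_cost_measure [simp]: "sets (cost_measure \<phi>) = UNIV"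
  by (simp add: cost_measure_def)

lemma emeasure_cost_measure:
  assumes "countable C"
  shows "emeasure (cost_measure \<phi>) C = (\<Sum>\<^sub>\<infinity>Q\<in>C. \<phi> (side_length Q))"
  unfolding cost_measure_def infsum_ennreal_eq_nn_integral[OF assms]
  by (simp add: emeasure_density nn_integral_count_space_indicator)

lemma emeasure_cost_measure_singleton [simp]:
  "emeasure (cost_measure \<phi>) {Q} = \<phi> (side_length Q)"
  by (simp add: emeasure_cost_measure)

lemma dyadic_content_eq_Inf:
  "dyadic_content a l \<phi> E =
     Inf {emeasure (cost_measure \<phi>) C |C. countable C \<and> C \<subseteq> dyadic_cubes a l \<and> E \<subseteq> \<Union>C}"
  unfolding dyadic_content_def setcompr_eq_image
  by (intro arg_cong[where f = Inf] image_cong refl) (simp add: emeasure_cost_measure)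

lemma dyadic_content_le_cost:
  assumes "countable C" "C \<subseteq> dyadic_cubes a l" "E \<subseteq> \<Union>C"
  shows "dyadic_content a l \<phi> E \<le> emeasure (cost_measure \<phi>) C"
  unfolding dyadic_content_eq_Inf using assms by (intro Inf_lower) blast

lemma Union_dyadic_orthants: "\<Union>(range (dyadic_orthant a)) = UNIV"
proof -
  have "x \<in> dyadic_orthant a {i. a $ i \<le> x $ i}" for x
    by (auto simp: dyadic_orthant_def)
  then show ?thesis by blast
qed

lemma dyadic_orthant_mem_cubes: "dyadic_orthant a S \<in> dyadic_cubes a l"
  by (auto simp: dyadic_cubes_def)

lemma dyadic_box_mem_cubes: "dyadic_box a l k m \<in> dyadic_cubes a l"
  by (auto simp: dyadic_cubes_def)

text \<open>If the content is infinite, any cover serves, and the finitely many orthants form one.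
  Otherwise adding \<open>e\<close> makes the inequality strict and the infimum yields a
  cover.\<close>

lemma dyadic_content_near_optimal_cover:
  fixes a :: "real ^ 'n"
  assumes "e > 0"
  obtains C where "countable C" "C \<subseteq> dyadic_cubes a l" "E \<subseteq> \<Union>C"
    "emeasure (cost_measure \<phi>) C \<le> dyadic_content a l \<phi> E + e"
proof (cases "dyadic_content a l \<phi> E = \<infinity>")
  case True
  have "range (dyadic_orthant a) \<subseteq> dyadic_cubes a l"
    by (auto simp: dyadic_orthant_mem_cubes)
  then show ?thesis
    using that[of "range (dyadic_orthant a)"] True by (simp add: Union_dyadic_orthants countable_finite)
next
  case False
  then have "dyadic_content a l \<phi> E < dyadic_content a l \<phi> E + e"
    using assms by (simp add: top.not_eq_extremum)
  then obtain C where "countable C" "C \<subseteq> dyadic_cubes a l" "E \<subseteq> \<Union>C"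
    "emeasure (cost_measure \<phi>) C < dyadic_content a l \<phi> E + e"
    unfolding dyadic_content_eq_Inf[of a l \<phi> E] Inf_less_iff by blast
  then show ?thesis using that by (meson less_imp_le)
qed

lemma dyadic_content_mono: "A \<subseteq> B \<Longrightarrow> dyadic_content a l \<phi> A \<le> dyadic_content a l \<phi> B"
  unfolding dyadic_content_eq_Inf by (intro Inf_superset_mono) blast

lemma dyadic_content_empty [simp]: "dyadic_content a l \<phi> {} = 0"
  using dyadic_content_le_cost[of "{}" a l "{}" \<phi>] by simp

lemma ennreal_suminf_geometric_half: "(\<Sum>n. ennreal (e * (1/2) ^ Suc n)) = ennreal e" if "e \<ge> 0"
proof -
  have "(\<lambda>n. e * (1/2) ^ Suc n) sums (e * 1)"
    by (intro sums_mult power_half_series)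
  then show ?thesis
    using that by (intro suminf_ennreal_eq) auto
qed

text \<open>Covers of the \<open>E n\<close> with errors \<open>e * (1/2) ^ Suc n\<close> are
  united; the errors add up to \<open>e\<close>.\<close>

lemma dyadic_content_UN_nat:
  fixes a :: "real ^ 'n"
  shows "dyadic_content a l \<phi> (\<Union>n::nat. E n) \<le> (\<Sum>n. dyadic_content a l \<phi> (E n))"
proof (rule ennreal_le_epsilon)
  fix e :: real assume e: "e > 0"
  have "\<exists>C. countable C \<and> C \<subseteq> dyadic_cubes a l \<and> E n \<subseteq> \<Union>C \<and>
    emeasure (cost_measure \<phi>) C \<le> dyadic_content a l \<phi> (E n) + ennreal (e * (1/2) ^ Suc n)" for n
  proof -
    have "ennreal (e * (1/2) ^ Suc n) > 0" using e by simp
    then show ?thesis using dyadic_content_near_optimal_cover by metis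
  qed
  then obtain C where C: "\<And>n. countable (C n)" "\<And>n. C n \<subseteq> dyadic_cubes a l" "\<And>n. E n \<subseteq> \<Union>(C n)"
    and le: "\<And>n. emeasure (cost_measure \<phi>) (C n) \<le> dyadic_content a l \<phi> (E n) + ennreal (e * (1/2) ^ Suc n)"
    by metis
  have "dyadic_content a l \<phi> (\<Union>n. E n) \<le> emeasure (cost_measure \<phi>) (\<Union>n. C n)"
  proof (rule dyadic_content_le_cost)
    show "(\<Union>n. E n) \<subseteq> \<Union>(\<Union>n. C n)" using C(3) by blast
    show "(\<Union>n. C n) \<subseteq> dyadic_cubes a l" using C(2) by blast
  qed (simp add: C(1))
  also have "\<dots> \<le> (\<Sum>n. emeasure (cost_measure \<phi>) (C n))"
    by (intro emeasure_subadditive_countably) auto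
  also have "\<dots> \<le> (\<Sum>n. dyadic_content a l \<phi> (E n) + ennreal (e * (1/2) ^ Suc n))"
    by (intro suminf_le le) auto
  also have "\<dots> = (\<Sum>n. dyadic_content a l \<phi> (E n)) + ennreal e"
    using e by (subst suminf_add[OF summableI summableI, symmetric])
      (subst ennreal_suminf_geometric_half, simp_all del: power_Suc)
  finally show "dyadic_content a l \<phi> (\<Union>n. E n) \<le> (\<Sum>n. dyadic_content a l \<phi> (E n)) + ennreal e" .
qed

lemma dyadic_content_UN:
  assumes "countable I"
  shows "dyadic_content a l \<phi> (\<Union>i\<in>I. E i) \<le> (\<integral>\<^sup>+i. dyadic_content a l \<phi> (E i) \<partial>count_space I)"
proof -
  define J where "J = to_nat_on I ` I"
  define F where "F n = (if n \<in> J then E (inv_into I (to_nat_on I) n) else {})" for n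
  have inj: "inj_on (to_nat_on I) I" using assms by (rule inj_on_to_nat_on)
  then have bij: "bij_betw (to_nat_on I) I J" by (simp add: J_def bij_betw_def)
  have F: "F (to_nat_on I i) = E i" if "i \<in> I" for i
    using that inj by (auto simp: F_def J_def)
  have "(\<Union>i\<in>I. E i) \<subseteq> (\<Union>n. F n)" using F by blast
  then have "dyadic_content a l \<phi> (\<Union>i\<in>I. E i) \<le> (\<Sum>n. dyadic_content a l \<phi> (F n))"
    by (rule order_trans[OF dyadic_content_mono dyadic_content_UN_nat])
  also have "\<dots> = (\<integral>\<^sup>+n. dyadic_content a l \<phi> (F n) \<partial>count_space UNIV)"
    by (simp add: nn_integral_count_space_nat)
  also have "\<dots> = (\<integral>\<^sup>+n. dyadic_content a l \<phi> (F n) \<partial>count_space J)"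
    by (intro nn_integral_count_space_eq) (auto simp: F_def)
  also have "\<dots> = (\<integral>\<^sup>+i. dyadic_content a l \<phi> (F (to_nat_on I i)) \<partial>count_space I)"
    by (rule nn_integral_bij_count_space[OF bij, symmetric])
  also have "\<dots> = (\<integral>\<^sup>+i. dyadic_content a l \<phi> (E i) \<partial>count_space I)"
    by (intro nn_integral_cong) (auto simp: F)
  finally show ?thesis .
qed

lemma dyadic_content_UN_finite:
  assumes "finite I"
  shows "dyadic_content a l \<phi> (\<Union>i\<in>I. E i) \<le> (\<Sum>i\<in>I. dyadic_content a l \<phi> (E i))"
  using dyadic_content_UN[of I a l \<phi> E] assms
  by (simp add: nn_integral_count_space_finite countable_finite)

lemma dyadic_content_Un:
  "dyadic_content a l \<phi> (A \<union> B) \<le> dyadic_content a l \<phi> A + dyadic_content a l \<phi> B"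
  using dyadic_content_UN_finite[of UNIV a l \<phi> "\<lambda>b. if b then A else B"]
  by (simp add: UNIV_bool Un_commute add.commute)

lemma dyadic_content_cube_le:
  assumes "P \<in> dyadic_cubes a l" "E \<subseteq> P"
  shows "dyadic_content a l \<phi> E \<le> \<phi> (side_length P)"
  using dyadic_content_le_cost[of "{P}" a l E \<phi>] assms by simp

section \<open>Nesting and translation of dyadic cubes through integer indices\<close>

definition dyadic_index :: "real ^ 'n \<Rightarrow> real \<Rightarrow> int \<Rightarrow> real ^ 'n \<Rightarrow> int ^ 'n" where
  "dyadic_index a l k x = (\<chi> i. \<lfloor>(x $ i - a $ i) / (2 powi k * l)\<rfloor>)"

lemma mem_dyadic_box_iff:
  assumes "l > 0"
  shows "x \<in> dyadic_box a l k m \<longleftrightarrow> dyadic_index a l k x = m"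
proof -
  define s where "s = 2 powi k * l"
  have s: "s > 0" using assms by (simp add: s_def)
  have "a $ i + s * of_int (m $ i) \<le> x $ i \<and> x $ i < a $ i + s * (of_int (m $ i) + 1) \<longleftrightarrow>
        \<lfloor>(x $ i - a $ i) / s\<rfloor> = m $ i" for i
    using s by (auto simp: floor_eq_iff field_simps)
  then show ?thesis
    by (simp add: dyadic_box_def dyadic_index_def vec_eq_iff flip: s_def)
qed

text \<open>Coarsening divides the rescaled coordinate by a positive integer, and the floor of such
  a quotient is the integer quotient of the floor.\<close>

lemma dyadic_index_coarsen:
  assumes "k \<le> j"
  shows "dyadic_index a l j x $ i = dyadic_index a l k x $ i div 2 ^ nat (j - k)"
proof -
  have "(2::real) powi j = 2 powi k * 2 powi (j - k)"
    by (subst power_int_add[symmetric]) auto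
  also have "(2::real) powi (j - k) = of_int (2 ^ nat (j - k))"
    using assms by (simp add: power_int_def)
  finally have "(x $ i - a $ i) / (2 powi j * l) =
      (x $ i - a $ i) / (2 powi k * l) / of_int (2 ^ nat (j - k))"
    by (simp add: mult_ac)
  then show ?thesis
    unfolding dyadic_index_def vec_lambda_beta
    by (simp only:) (rule floor_divide_real_eq_div, simp)
qed

text \<open>The corner \<open>a\<close> is a lattice vertex at every scale, so the signs of the
  index at any one scale determine the orthant. Hence a box never straddles two orthants.\<close>

lemma mem_dyadic_orthant_iff:
  assumes "l > 0"
  shows "x \<in> dyadic_orthant a S \<longleftrightarrow> (\<forall>i. i \<in> S \<longleftrightarrow> 0 \<le> dyadic_index a l k x $ i)"
proof -
  have "0 < 2 powi k * l" using assms by simp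
  then have "0 \<le> dyadic_index a l k x $ i \<longleftrightarrow> a $ i \<le> x $ i" for i
    unfolding dyadic_index_def vec_lambda_beta zero_le_floor
    by (subst zero_le_divide_iff) auto
  moreover have "x \<in> dyadic_orthant a S \<longleftrightarrow> (\<forall>i. i \<in> S \<longleftrightarrow> a $ i \<le> x $ i)"
    by (simp add: dyadic_orthant_def) (meson not_le)
  ultimately show ?thesis by simp
qed

lemma dyadic_index_coarsen_eq:
  assumes "k \<le> j" "dyadic_index a l k x = dyadic_index a l k y"
  shows "dyadic_index a l j x = dyadic_index a l j y"
  using assms by (simp add: vec_eq_iff dyadic_index_coarsen[OF assms(1)])

lemma dyadic_box_subset:
  assumes "l > 0" "k \<le> j" "x \<in> dyadic_box a l k m" "x \<in> dyadic_box a l j m'"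
  shows "dyadic_box a l k m \<subseteq> dyadic_box a l j m'"
  using assms dyadic_index_coarsen_eq[OF assms(2)] by (auto simp: mem_dyadic_box_iff)

lemma dyadic_box_corner_mem:
  "l > 0 \<Longrightarrow> (\<chi> i. a $ i + 2 powi k * l * of_int (m $ i)) \<in> dyadic_box a l k m"
  by (auto simp: dyadic_box_def)

lemma dyadic_box_nonempty: "l > 0 \<Longrightarrow> dyadic_box a l k m \<noteq> {}"
  using dyadic_box_corner_mem by blast

text \<open>Two boxes that meet are compared by scale; an orthant contains every box it meets. The
  bound \<open>j \<le> k\<close> is recorded because translating \<open>P\<close> within the lattice
  relies on it.\<close>

lemma dyadic_box_cube_cases:
  assumes "l > 0" "P \<in> dyadic_cubes a l" "x \<in> dyadic_box a l k m" "x \<in> P"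
  obtains "dyadic_box a l k m \<subseteq> P"
  | j m' where "P = dyadic_box a l j m'" "j \<le> k" "P \<subseteq> dyadic_box a l k m"
proof -
  consider j m' where "P = dyadic_box a l j m'" | S where "P = dyadic_orthant a S"
    using assms(2) by (auto simp: dyadic_cubes_def)
  then show ?thesis
  proof cases
    case 1
    show ?thesis
    proof (cases "k \<le> j")
      case True
      then show ?thesis using assms 1 dyadic_box_subset that(1) by metis
    next
      case False
      then have "P \<subseteq> dyadic_box a l k m"
        using assms 1 dyadic_box_subset[of l j k x a m' m] by auto
      then show ?thesis using False 1 that(2) by auto
    qed
  next
    case 2
    have "dyadic_box a l k m \<subseteq> P"
      using assms 2 by (auto simp: mem_dyadic_orthant_iff[OF assms(1), of _ _ _ k] mem_dyadic_box_iff)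
    then show ?thesis by (rule that(1))
  qed
qed

lemma side_length_mono: "A \<subseteq> B \<Longrightarrow> side_length A \<le> side_length B"
  unfolding side_length_def by (intro SUP_subset_mono) auto

lemma side_length_translation: "side_length ((+) v ` A) = side_length A"
  by (simp add: side_length_def image_image)

lemma dyadic_box_subset_imp_le:
  assumes "l > 0" "dyadic_box a l k m \<subseteq> dyadic_box a l j m'"
  shows "k \<le> j"
proof (rule ccontr)
  assume "\<not> k \<le> j"
  then have "(2::real) powi j < 2 powi k" by (intro power_int_strict_increasing) auto
  then have "ennreal (2 powi j * l) < ennreal (2 powi k * l)"
    using assms(1) by (intro ennreal_lessI) auto
  with side_length_mono[OF assms(2)] show False
    unfolding side_length_dyadic_box[OF assms(1)] by (rule leD[THEN notE])
qed

text \<open>A shift by whole sides at scale \<open>k\<close> is a shift by whole sides at every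
  finer scale, so it preserves the finer lattices.\<close>

lemma dyadic_box_translation:
  fixes a :: "real ^ 'n" and v :: "int ^ 'n"
  assumes "j \<le> k"
  shows "(+) (\<chi> i. 2 powi k * l * of_int (v $ i)) ` dyadic_box a l j m =
    dyadic_box a l j (\<chi> i. m $ i + 2 ^ nat (k - j) * v $ i)"
proof -
  define w :: "real ^ 'n" where "w = (\<chi> i. 2 powi k * l * of_int (v $ i))"
  have "(2::real) powi k = 2 powi j * 2 powi (k - j)"
    by (subst power_int_add[symmetric]) auto
  also have "(2::real) powi (k - j) = 2 ^ nat (k - j)"
    using assms by (simp add: power_int_def)
  finally have p: "(2::real) powi k = 2 powi j * 2 ^ nat (k - j)" .
  have mem: "w + x \<in> dyadic_box a l j (\<chi> i. m $ i + 2 ^ nat (k - j) * v $ i) \<longleftrightarrow>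
      x \<in> dyadic_box a l j m" for x
    unfolding dyadic_box_def w_def p by (simp add: algebra_simps)
  have "y \<in> (+) w ` dyadic_box a l j m" if "y \<in> dyadic_box a l j (\<chi> i. m $ i + 2 ^ nat (k - j) * v $ i)" for y
    using mem[of "y - w"] that by (intro image_eqI[of _ _ "y - w"]) auto
  then show ?thesis
    unfolding w_def[symmetric] using mem by auto
qed

section \<open>Neighbouring boxes and dilated cubes\<close>

text \<open>The tolerance comes from balls: the scale \<open>s\<close> is later chosen with
  \<open>r < 2 * CARD('n) * s\<close>, so points of \<open>ball x r\<close> have indices within this
  distance of that of \<open>x\<close>.\<close>

definition dyadic_near :: "real ^ 'n \<Rightarrow> real \<Rightarrow> int \<Rightarrow> real ^ 'n \<Rightarrow> real ^ 'n \<Rightarrow> bool" where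
  "dyadic_near a l k x y \<longleftrightarrow>
     (\<forall>i. \<bar>dyadic_index a l k x $ i - dyadic_index a l k y $ i\<bar> \<le> 2 * int CARD('n))"

text \<open>For \<open>q \<le> p\<close> one has \<open>p \<le> q + (p - q) * c\<close>, and
  division by \<open>c\<close> is exact on the added multiple. This lets nearness survive
  coarsening.\<close>

lemma abs_div_diff_le:
  fixes p q c :: int
  assumes "c > 0"
  shows "\<bar>p div c - q div c\<bar> \<le> \<bar>p - q\<bar>"
proof -
  have *: "p div c - q div c \<le> p - q" if "q \<le> p" for p q
  proof -
    have "p \<le> q + (p - q) * c"
      using that assms mult_left_mono[of 1 c "p - q"] by simp
    then have "p div c \<le> (q + (p - q) * c) div c"
      using assms by (intro zdiv_mono1)
    also have "\<dots> = q div c + (p - q)" using assms by simp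
    finally show ?thesis by simp
  qed
  show ?thesis
    using *[of p q] *[of q p] assms zdiv_mono1[of p q c] zdiv_mono1[of q p c] by linarith
qed

lemma dyadic_near_coarsen:
  assumes "k \<le> j" "dyadic_near a l k x y"
  shows "dyadic_near a l j x y"
  unfolding dyadic_near_def dyadic_index_coarsen[OF assms(1)]
  using assms(2) abs_div_diff_le[of "2 ^ nat (j - k)"]
  by (auto simp: dyadic_near_def intro: order_trans)

text \<open>Referring to subboxes of all scales makes the notion meaningful for orthants, and puts a
  point near a small box into the dilation of every cube containing that box.\<close>

definition dyadic_dilation :: "real ^ 'n \<Rightarrow> real \<Rightarrow> (real ^ 'n) set \<Rightarrow> (real ^ 'n) set" where
  "dyadic_dilation a l P =
     {x. \<exists>k y. dyadic_box a l k (dyadic_index a l k y) \<subseteq> P \<and> dyadic_near a l k x y}"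

definition near_offsets :: "(int ^ 'n) set" where
  "near_offsets = {v. \<forall>i. \<bar>v $ i\<bar> \<le> 2 * int CARD('n)}"

lemma finite_near_offsets: "finite (near_offsets :: (int ^ 'n) set)"
proof (rule finite_imageD)
  have "vec_nth ` (near_offsets :: (int ^ 'n) set) \<subseteq>
      (\<Pi>\<^sub>E i\<in>UNIV. {- (2 * int CARD('n))..2 * int CARD('n)})"
    by (auto simp: near_offsets_def abs_le_iff minus_le_iff)
  then show "finite (vec_nth ` (near_offsets :: (int ^ 'n) set))"
    by (rule finite_subset) (intro finite_PiE, auto)
  show "inj_on vec_nth (near_offsets :: (int ^ 'n) set)"
    by (auto simp: inj_on_def vec_eq_iff)
qed

text \<open>The second summand accounts for orthants, whose dilation can be the whole space.\<close>

definition overlap_bound :: "'n::finite itself \<Rightarrow> nat" where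
  "overlap_bound _ = card (near_offsets :: (int ^ 'n) set) + card (UNIV :: 'n set set)"

lemma dyadic_near_imp_box_offset:
  fixes x y :: "real ^ 'n"
  assumes "l > 0" "dyadic_near a l k x y"
  shows "x \<in> (\<Union>v\<in>near_offsets. dyadic_box a l k (dyadic_index a l k y + v))"
proof
  show "dyadic_index a l k x - dyadic_index a l k y \<in> near_offsets"
    using assms(2) by (simp add: dyadic_near_def near_offsets_def)
qed (simp add: mem_dyadic_box_iff[OF assms(1)])

text \<open>A box inside another has no larger scale, so nearness at its scale coarsens to nearness
  at scale \<open>k\<close>.\<close>

lemma dyadic_dilation_box_subset:
  assumes "l > 0"
  shows "dyadic_dilation a l (dyadic_box a l k m) \<subseteq>
    (\<Union>v\<in>near_offsets. dyadic_box a l k (m + v))"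
proof
  fix x assume "x \<in> dyadic_dilation a l (dyadic_box a l k m)"
  then obtain j y where sub: "dyadic_box a l j (dyadic_index a l j y) \<subseteq> dyadic_box a l k m"
    and near: "dyadic_near a l j x y"
    by (auto simp: dyadic_dilation_def)
  have "dyadic_index a l k y = m"
    using sub assms by (auto simp: mem_dyadic_box_iff)
  moreover have "dyadic_near a l k x y"
    using dyadic_near_coarsen near dyadic_box_subset_imp_le[OF assms sub] by blast
  ultimately show "x \<in> (\<Union>v\<in>near_offsets. dyadic_box a l k (m + v))"
    using dyadic_near_imp_box_offset assms by blast
qed

section \<open>Translation invariance of the content and content of dilations\<close>

text \<open>A cover of the second box either has a member containing it, which by monotonicity costs
  at least as much as the first box itself, or its relevant members lie inside the box and can be
  translated at equal cost.\<close>

lemma dyadic_content_box_le_translate: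
  fixes a :: "real ^ 'n"
  assumes l: "l > 0" and "mono \<phi>"
  shows "dyadic_content a l \<phi> (dyadic_box a l k m) \<le> dyadic_content a l \<phi> (dyadic_box a l k m')"
  unfolding dyadic_content_eq_Inf[of a l \<phi> "dyadic_box a l k m'"]
proof (rule Inf_greatest, safe)
  fix C assume C: "countable C" "C \<subseteq> dyadic_cubes a l" "dyadic_box a l k m' \<subseteq> \<Union>C"
  show "dyadic_content a l \<phi> (dyadic_box a l k m) \<le> emeasure (cost_measure \<phi>) C"
  proof (cases "\<exists>P\<in>C. dyadic_box a l k m' \<subseteq> P")
    case True
    then obtain P where P: "P \<in> C" "dyadic_box a l k m' \<subseteq> P" by blast
    have "dyadic_content a l \<phi> (dyadic_box a l k m) \<le> \<phi> (side_length (dyadic_box a l k m))"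
      by (intro dyadic_content_cube_le dyadic_box_mem_cubes order_refl)
    also have "\<dots> \<le> \<phi> (side_length P)"
      using side_length_mono[OF P(2)] l \<open>mono \<phi>\<close> by (simp add: side_length_dyadic_box monoD)
    also have "\<dots> = emeasure (cost_measure \<phi>) {P}" by simp
    also have "\<dots> \<le> emeasure (cost_measure \<phi>) C"
      using P(1) by (intro emeasure_mono) auto
    finally show ?thesis .
  next
    case False
    \<comment> \<open>Removing the empty set guarantees each member a point, which the nesting
      dichotomy takes as input.\<close>
    define D where "D = {P \<in> C. P \<subseteq> dyadic_box a l k m'} - {{}}"
    define T where "T = (+) (\<chi> i. 2 powi k * l * of_int ((m - m') $ i))"
    have "inj T" by (simp add: T_def inj_on_def)
    have D: "countable D" using C(1) by (auto simp: D_def)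
    have T_box: "T ` dyadic_box a l k m' = dyadic_box a l k m"
    proof -
      have "(\<chi> i. m' $ i + 2 ^ nat (k - k) * (m - m') $ i) = m" by (simp add: vec_eq_iff)
      then show ?thesis unfolding T_def by (simp only: dyadic_box_translation[OF order_refl])
    qed
    have "dyadic_box a l k m' \<subseteq> \<Union>D"
    proof
      fix x assume x: "x \<in> dyadic_box a l k m'"
      then obtain P where P: "P \<in> C" "x \<in> P" using C(3) by blast
      then show "x \<in> \<Union>D"
        using dyadic_box_cube_cases[OF l _ x, of P] False C(2) by (auto simp: D_def)
    qed
    then have "dyadic_box a l k m \<subseteq> \<Union>((`) T ` D)"
      unfolding T_box[symmetric] by blast
    moreover have "(`) T ` D \<subseteq> dyadic_cubes a l"
    proof safe
      fix P assume P: "P \<in> D"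
      then obtain x where x: "x \<in> P" "x \<in> dyadic_box a l k m'" by (auto simp: D_def)
      have "P \<in> dyadic_cubes a l" "\<not> dyadic_box a l k m' \<subseteq> P" using P C(2) False by (auto simp: D_def)
      then obtain j q where "P = dyadic_box a l j q" "j \<le> k"
        using dyadic_box_cube_cases[OF l _ x(2,1)] by metis
      then show "T ` P \<in> dyadic_cubes a l"
        by (simp only: T_def dyadic_box_translation dyadic_box_mem_cubes)
    qed
    ultimately have "dyadic_content a l \<phi> (dyadic_box a l k m) \<le> emeasure (cost_measure \<phi>) ((`) T ` D)"
      using D by (intro dyadic_content_le_cost) auto
    also have "\<dots> = (\<Sum>\<^sub>\<infinity>P\<in>D. \<phi> (side_length (T ` P)))"
      using D inj_on_image[OF inj_on_subset[OF \<open>inj T\<close>], of D]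
      by (simp add: emeasure_cost_measure infsum_reindex o_def)
    also have "\<dots> = emeasure (cost_measure \<phi>) D"
      using D by (simp add: emeasure_cost_measure T_def side_length_translation)
    also have "\<dots> \<le> emeasure (cost_measure \<phi>) C"
      by (intro emeasure_mono) (auto simp: D_def)
    finally show ?thesis .
  qed
qed

lemma dyadic_content_box_translate:
  assumes "l > 0" "mono \<phi>"
  shows "dyadic_content a l \<phi> (dyadic_box a l k m) = dyadic_content a l \<phi> (dyadic_box a l k m')"
  using dyadic_content_box_le_translate[OF assms] by (intro antisym)

text \<open>All neighbours have equal content. The bound uses the content of the box instead of
  \<open>\<phi>\<close> of its side, because badness of a box bounds its content.\<close>

lemma dyadic_content_dilation_box:
  fixes a :: "real ^ 'n"
  assumes "l > 0" "mono \<phi>"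
  shows "dyadic_content a l \<phi> (dyadic_dilation a l (dyadic_box a l k m)) \<le>
    of_nat (overlap_bound TYPE('n)) * dyadic_content a l \<phi> (dyadic_box a l k m)"
proof -
  have "dyadic_content a l \<phi> (dyadic_dilation a l (dyadic_box a l k m)) \<le>
      (\<Sum>v\<in>near_offsets. dyadic_content a l \<phi> (dyadic_box a l k (m + v)))"
    using dyadic_content_mono[OF dyadic_dilation_box_subset[OF assms(1)]]
      dyadic_content_UN_finite[OF finite_near_offsets] by (rule order_trans)
  also have "\<dots> = (\<Sum>v\<in>(near_offsets :: (int ^ 'n) set). dyadic_content a l \<phi> (dyadic_box a l k m))"
    using dyadic_content_box_translate[OF assms] by (intro sum.cong refl)
  also have "\<dots> \<le> of_nat (overlap_bound TYPE('n)) * dyadic_content a l \<phi> (dyadic_box a l k m)"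
    by (simp add: overlap_bound_def distrib_right)
  finally show ?thesis .
qed

text \<open>For an orthant, the dilation is covered by all orthants, which share the infinite side
  length and hence the cost.\<close>

lemma dyadic_content_dilation_cube:
  fixes a :: "real ^ 'n"
  assumes "l > 0" "mono \<phi>" "P \<in> dyadic_cubes a l"
  shows "dyadic_content a l \<phi> (dyadic_dilation a l P) \<le>
    of_nat (overlap_bound TYPE('n)) * \<phi> (side_length P)"
proof -
  consider k m where "P = dyadic_box a l k m" | S where "P = dyadic_orthant a S"
    using assms(3) by (auto simp: dyadic_cubes_def)
  then show ?thesis
  proof cases
    case 1
    have "of_nat (overlap_bound TYPE('n)) * dyadic_content a l \<phi> P \<le>
        of_nat (overlap_bound TYPE('n)) * \<phi> (side_length P)"
      using dyadic_content_cube_le[OF assms(3) order_refl] by (intro mult_left_mono) auto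
    then show ?thesis
      using dyadic_content_dilation_box[OF assms(1,2), of a k m] 1 order_trans by blast
  next
    case 2
    have "dyadic_content a l \<phi> (dyadic_dilation a l P) \<le>
        dyadic_content a l \<phi> (\<Union>S. dyadic_orthant a S)"
      by (intro dyadic_content_mono) (simp add: Union_dyadic_orthants)
    also have "\<dots> \<le> (\<Sum>S\<in>UNIV. dyadic_content a l \<phi> (dyadic_orthant a S))"
      by (intro dyadic_content_UN_finite) simp
    also have "\<dots> \<le> (\<Sum>S\<in>(UNIV :: 'n set set). \<phi> (side_length P))"
      unfolding 2
      by (intro sum_mono order_trans[OF dyadic_content_cube_le[OF dyadic_orthant_mem_cubes order_refl]])
         (simp add: side_length_dyadic_orthant)
    also have "\<dots> \<le> of_nat (overlap_bound TYPE('n)) * \<phi> (side_length P)"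
      by (simp add: overlap_bound_def distrib_right)
    finally show ?thesis .
  qed
qed

section \<open>The weak type estimate\<close>

lemma emeasure_cost_measure_eq_nn_integral:
  "countable C \<Longrightarrow> emeasure (cost_measure \<phi>) C = (\<integral>\<^sup>+Q. \<phi> (side_length Q) \<partial>count_space C)"
  by (simp add: emeasure_cost_measure infsum_ennreal_eq_nn_integral)

text \<open>The factor 2 adds the contributions of bad boxes inside a covering cube and of the
  remaining ones. The restriction \<open>k \<le> 0\<close> makes maximal bad boxes exist.\<close>

lemma dyadic_content_bad_boxes_le_cover_cost:
  fixes a :: "real ^ 'n" and A :: "nat \<Rightarrow> (real ^ 'n) set"
  assumes l: "l > 0" and "mono \<phi>"
    and C: "\<And>n. countable (C n)" "\<And>n. C n \<subseteq> dyadic_cubes a l" "\<And>n. A n \<subseteq> \<Union>(C n)"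
  shows "dyadic_content a l \<phi>
      {x. \<exists>k y. k \<le> 0 \<and> dyadic_near a l k x y \<and>
          dyadic_content a l \<phi> (dyadic_box a l k (dyadic_index a l k y)) <
          (\<Sum>n. 2 ^ n * dyadic_content a l \<phi> (dyadic_box a l k (dyadic_index a l k y) \<inter> A n))} \<le>
    2 * of_nat (overlap_bound TYPE('n)) * (\<Sum>n. 2 ^ n * emeasure (cost_measure \<phi>) (C n))"
    (is "dyadic_content _ _ _ ?E \<le> 2 * ?N * ?S")
proof -
  let ?H = "dyadic_content a l \<phi>"
  let ?\<mu> = "emeasure (cost_measure \<phi>)"
  \<comment> \<open>Pairs of scale and index keep the scale accessible and form a countable
    type.\<close>
  define bx where "bx p = dyadic_box a l (fst p) (snd p)" for p :: "int \<times> (int ^ 'n)"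
  define G where "G = (\<Union>n. C n)"
  define B where "B = {p. fst p \<le> 0 \<and> ?H (bx p) < (\<Sum>n. 2 ^ n * ?H (bx p \<inter> A n)) \<and>
    (\<forall>P\<in>G. \<not> bx p \<subseteq> P)}"
  define M where "M = {p \<in> B. \<forall>q\<in>B. bx p \<subseteq> bx q \<longrightarrow> fst q \<le> fst p}"
  define D where "D p n = {P \<in> C n. P \<subseteq> bx p \<and> P \<noteq> {}}" for p n
  have G: "countable G" "G \<subseteq> dyadic_cubes a l"
    using C unfolding G_def by auto
  have cover: "?E \<subseteq> (\<Union>P\<in>G. dyadic_dilation a l P) \<union> (\<Union>p\<in>M. dyadic_dilation a l (bx p))"
  proof
    fix x assume "x \<in> ?E"
    then obtain k y where k: "k \<le> 0" and near: "dyadic_near a l k x y"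
      and bad: "?H (bx (k, dyadic_index a l k y)) <
        (\<Sum>n. 2 ^ n * ?H (bx (k, dyadic_index a l k y) \<inter> A n))"
      unfolding bx_def by auto
    define p where "p = (k, dyadic_index a l k y)"
    have dil: "x \<in> dyadic_dilation a l P" if "bx p \<subseteq> P" for P
      using that near unfolding dyadic_dilation_def p_def bx_def by auto
    show "x \<in> (\<Union>P\<in>G. dyadic_dilation a l P) \<union> (\<Union>p\<in>M. dyadic_dilation a l (bx p))"
    proof (cases "\<exists>P\<in>G. bx p \<subseteq> P")
      case True
      then show ?thesis using dil by blast
    next
      case False
      then have "p \<in> B" using k bad unfolding B_def p_def by auto
      then have "p \<in> B \<and> bx p \<subseteq> bx p" by simp
      \<comment> \<open>Scales are at most 0, so a largest scale is a least value of the natural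
        number \<open>nat (- fst q)\<close>.\<close>
      from ex_has_least_nat[of "\<lambda>q. q \<in> B \<and> bx p \<subseteq> bx q", OF this, of "\<lambda>q. nat (- fst q)"]
      obtain q where q: "q \<in> B" "bx p \<subseteq> bx q"
        and least: "\<And>r. r \<in> B \<Longrightarrow> bx p \<subseteq> bx r \<Longrightarrow> nat (- fst q) \<le> nat (- fst r)"
        by blast
      have "fst r \<le> fst q" if "r \<in> B" "bx q \<subseteq> bx r" for r
      proof -
        have "nat (- fst q) \<le> nat (- fst r)" using that q(2) by (intro least) auto
        moreover have "fst q \<le> 0" "fst r \<le> 0" using that(1) q(1) by (auto simp: B_def)
        ultimately show ?thesis by linarith
      qed
      then have "q \<in> M" using q(1) by (auto simp: M_def)
      then show ?thesis using dil q(2) by blast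
    qed
  qed
  have "?H (\<Union>P\<in>G. dyadic_dilation a l P) \<le> (\<integral>\<^sup>+P. ?H (dyadic_dilation a l P) \<partial>count_space G)"
    by (rule dyadic_content_UN[OF G(1)])
  also have "\<dots> \<le> (\<integral>\<^sup>+P. ?N * \<phi> (side_length P) \<partial>count_space G)"
    using G(2) by (intro nn_integral_mono dyadic_content_dilation_cube l \<open>mono \<phi>\<close>) auto
  also have "\<dots> = ?N * ?\<mu> G"
    using G(1) by (simp add: nn_integral_cmult emeasure_cost_measure_eq_nn_integral)
  also have "?\<mu> G \<le> (\<Sum>n. ?\<mu> (C n))"
    unfolding G_def by (intro emeasure_subadditive_countably) auto
  also have "\<dots> \<le> ?S"
  proof (intro suminf_le summableI)
    show "?\<mu> (C n) \<le> 2 ^ n * ?\<mu> (C n)" for n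
      using mult_right_mono[of 1 "2 ^ n :: ennreal" "?\<mu> (C n)"] by simp
  qed
  finally have covered: "?H (\<Union>P\<in>G. dyadic_dilation a l P) \<le> ?N * ?S"
    by (simp add: mult_left_mono)
  \<comment> \<open>No covering cube contains \<open>bx p\<close>, so those meeting it lie inside it
    and already cover \<open>bx p \<inter> A n\<close>.\<close>
  have D: "?H (bx p \<inter> A n) \<le> ?\<mu> (D p n)" if "p \<in> B" for p n
  proof (rule dyadic_content_le_cost)
    show "countable (D p n)" "D p n \<subseteq> dyadic_cubes a l"
      using C(1)[of n] C(2)[of n] by (auto simp: D_def)
    show "bx p \<inter> A n \<subseteq> \<Union>(D p n)"
    proof safe
      fix x assume x: "x \<in> bx p" "x \<in> A n"
      then obtain P where P: "P \<in> C n" "x \<in> P" using C(3) by blast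
      then have "P \<in> G" "P \<in> dyadic_cubes a l" using C(2) by (auto simp: G_def)
      moreover have "\<not> bx p \<subseteq> P" using that \<open>P \<in> G\<close> by (auto simp: B_def)
      ultimately have "P \<subseteq> bx p"
        using dyadic_box_cube_cases[OF l _ _ P(2)] x(1) unfolding bx_def by metis
      then show "x \<in> \<Union>(D p n)" using P by (auto simp: D_def)
    qed
  qed
  \<comment> \<open>A cube in both families gives a common point of the two boxes; they are then
    nested, maximality equates their scales, and the common point equates their indices.\<close>
  have disj: "disjoint_family_on (\<lambda>p. D p n) M" for n
    unfolding disjoint_family_on_def
  proof (intro ballI impI)
    fix p q assume pq: "p \<in> M" "q \<in> M" "p \<noteq> q"
    have False if P: "P \<in> D p n" "P \<in> D q n" for P
    proof -
      obtain x where x: "x \<in> bx p" "x \<in> bx q" using P by (auto simp: D_def)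
      have le: "fst q' \<le> fst p'" if "p' \<in> M" "q' \<in> M" "fst p' \<le> fst q'" "x \<in> bx p'" "x \<in> bx q'" for p' q'
      proof -
        have "bx p' \<subseteq> bx q'"
          using that(3-5) unfolding bx_def by (intro dyadic_box_subset[OF l])
        then show ?thesis using that(1,2) by (auto simp: M_def)
      qed
      have "fst p = fst q"
        using le[of p q] le[of q p] pq x by linarith
      moreover have "snd p = snd q"
        using x calculation by (simp add: bx_def mem_dyadic_box_iff[OF l])
      ultimately show False using pq(3) by (simp add: prod_eq_iff)
    qed
    then show "D p n \<inter> D q n = {}" by blast
  qed
  have "?H (\<Union>p\<in>M. dyadic_dilation a l (bx p)) \<le>
      (\<integral>\<^sup>+p. ?H (dyadic_dilation a l (bx p)) \<partial>count_space M)"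
    by (intro dyadic_content_UN) simp
  also have "\<dots> \<le> (\<integral>\<^sup>+p. ?N * (\<Sum>n. 2 ^ n * ?\<mu> (D p n)) \<partial>count_space M)"
  proof (intro nn_integral_mono)
    fix p assume "p \<in> space (count_space M)"
    then have p: "p \<in> B" by (simp add: M_def)
    have "?H (dyadic_dilation a l (bx p)) \<le> ?N * ?H (bx p)"
      unfolding bx_def by (intro dyadic_content_dilation_box l \<open>mono \<phi>\<close>)
    also have "?H (bx p) \<le> (\<Sum>n. 2 ^ n * ?H (bx p \<inter> A n))"
      using p by (auto simp: B_def)
    also have "\<dots> \<le> (\<Sum>n. 2 ^ n * ?\<mu> (D p n))"
      by (intro suminf_le summableI mult_left_mono D p) simp
    finally show "?H (dyadic_dilation a l (bx p)) \<le> ?N * (\<Sum>n. 2 ^ n * ?\<mu> (D p n))"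
      by (simp add: mult_left_mono)
  qed
  \<comment> \<open>Levels and boxes are interchanged, so that for each level the disjoint families
    can be merged by countable additivity.\<close>
  also have "\<dots> = ?N * (\<Sum>n. \<integral>\<^sup>+p. 2 ^ n * ?\<mu> (D p n) \<partial>count_space M)"
    by (subst nn_integral_cmult) (simp_all add: nn_integral_suminf)
  also have "\<dots> = ?N * (\<Sum>n. 2 ^ n * ?\<mu> (\<Union>p\<in>M. D p n))"
    by (simp add: nn_integral_cmult emeasure_UN_countable[OF _ _ disj])
  also have "\<dots> \<le> ?N * ?S"
    by (intro mult_left_mono suminf_le summableI emeasure_mono) (auto simp: D_def)
  finally have uncovered: "?H (\<Union>p\<in>M. dyadic_dilation a l (bx p)) \<le> ?N * ?S" .
  have "?H ?E \<le> ?H (\<Union>P\<in>G. dyadic_dilation a l P) + ?H (\<Union>p\<in>M. dyadic_dilation a l (bx p))"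
    by (rule order_trans[OF dyadic_content_mono[OF cover] dyadic_content_Un])
  also have "\<dots> \<le> ?N * ?S + ?N * ?S" by (intro add_mono covered uncovered)
  also have "\<dots> = 2 * ?N * ?S" by (simp add: mult_2 distrib_right)
  finally show ?thesis .
qed

lemma dyadic_content_bad_boxes_le:
  fixes a :: "real ^ 'n" and A :: "nat \<Rightarrow> (real ^ 'n) set"
  assumes "l > 0" "mono \<phi>"
  shows "dyadic_content a l \<phi>
      {x. \<exists>k y. k \<le> 0 \<and> dyadic_near a l k x y \<and>
          dyadic_content a l \<phi> (dyadic_box a l k (dyadic_index a l k y)) <
          (\<Sum>n. 2 ^ n * dyadic_content a l \<phi> (dyadic_box a l k (dyadic_index a l k y) \<inter> A n))} \<le>
    2 * of_nat (overlap_bound TYPE('n)) * (\<Sum>n. 2 ^ n * dyadic_content a l \<phi> (A n))"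
    (is "dyadic_content _ _ _ ?E \<le> 2 * ?N * ?S")
proof (rule ennreal_le_epsilon)
  let ?H = "dyadic_content a l \<phi>"
  fix e :: real assume "e > 0"
  \<comment> \<open>The added 1 keeps the denominator positive whatever the value of
    \<open>overlap_bound\<close>.\<close>
  define d where "d = e / (2 * real (overlap_bound TYPE('n)) + 1)"
  have d: "d > 0" using \<open>e > 0\<close> by (simp add: d_def)
  have "2 * real (overlap_bound TYPE('n)) * d \<le> e"
    using \<open>e > 0\<close> by (simp add: d_def field_simps)
  then have Nd: "2 * ?N * ennreal d \<le> ennreal e"
    using d by (simp add: ennreal_of_nat_eq_real_of_nat ennreal_mult[symmetric] ennreal_leI
        flip: ennreal_numeral)
  \<comment> \<open>Dividing the error by \<open>2 ^ n\<close> cancels the weight of level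
    \<open>n\<close>; the weighted errors then sum to \<open>d\<close>.\<close>
  have "\<exists>C. countable C \<and> C \<subseteq> dyadic_cubes a l \<and> A n \<subseteq> \<Union>C \<and>
    emeasure (cost_measure \<phi>) C \<le> ?H (A n) + ennreal (d * (1/2) ^ Suc n / 2 ^ n)" for n
  proof -
    have "ennreal (d * (1/2) ^ Suc n / 2 ^ n) > 0" using d by simp
    then show ?thesis using dyadic_content_near_optimal_cover by metis
  qed
  then obtain C where C: "\<And>n. countable (C n)" "\<And>n. C n \<subseteq> dyadic_cubes a l" "\<And>n. A n \<subseteq> \<Union>(C n)"
    and le: "\<And>n. emeasure (cost_measure \<phi>) (C n) \<le> ?H (A n) + ennreal (d * (1/2) ^ Suc n / 2 ^ n)"
    by metis
  have "2 ^ n * emeasure (cost_measure \<phi>) (C n) \<le> 2 ^ n * ?H (A n) + ennreal (d * (1/2) ^ Suc n)" for n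
  proof -
    have "2 ^ n * emeasure (cost_measure \<phi>) (C n) \<le>
        2 ^ n * (?H (A n) + ennreal (d * (1/2) ^ Suc n / 2 ^ n))"
      by (intro mult_left_mono le) simp
    also have "2 ^ n * ennreal (d * (1/2) ^ Suc n / 2 ^ n) = ennreal (2 ^ n * (d * (1/2) ^ Suc n / 2 ^ n))"
      using d by (subst ennreal_mult) (simp_all flip: ennreal_power ennreal_numeral)
    ultimately show ?thesis by (simp add: distrib_left)
  qed
  then have "(\<Sum>n. 2 ^ n * emeasure (cost_measure \<phi>) (C n)) \<le>
      (\<Sum>n. 2 ^ n * ?H (A n) + ennreal (d * (1/2) ^ Suc n))"
    by (intro suminf_le summableI)
  also have "\<dots> = ?S + ennreal d"
    using d by (subst suminf_add[OF summableI summableI, symmetric])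
      (subst ennreal_suminf_geometric_half, simp_all del: power_Suc)
  finally have "2 * ?N * (\<Sum>n. 2 ^ n * emeasure (cost_measure \<phi>) (C n)) \<le> 2 * ?N * (?S + ennreal d)"
    by (rule mult_left_mono) simp
  also have "\<dots> \<le> 2 * ?N * ?S + ennreal e"
    using Nd by (simp add: distrib_left)
  finally show "?H ?E \<le> 2 * ?N * ?S + ennreal e"
    by (rule order_trans[OF dyadic_content_bad_boxes_le_cover_cost[OF assms C]])
qed

section \<open>Choquet integrals and geometric sequences of levels\<close>

lemma disjoint_family_geometric_Ico:
  assumes "c > (0::real)"
  shows "disjoint_family (\<lambda>n. {c * 2 ^ n..<c * 2 ^ Suc n})"
proof -
  have *: "{c * 2 ^ m..<c * 2 ^ Suc m} \<inter> {c * 2 ^ n..<c * 2 ^ Suc n} = {}" if "m < n" for m n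
  proof -
    have "(2::real) ^ Suc m \<le> 2 ^ n" using that by (intro power_increasing) auto
    then have "c * 2 ^ Suc m \<le> c * 2 ^ n" using assms by (intro mult_left_mono) auto
    then show ?thesis by auto
  qed
  show ?thesis
    unfolding disjoint_family_on_def
  proof (intro ballI impI)
    fix m n :: nat assume "m \<noteq> n"
    then show "{c * 2 ^ m..<c * 2 ^ Suc m} \<inter> {c * 2 ^ n..<c * 2 ^ Suc n} = {}"
      using *[of m n] *[of n m] by (metis Int_commute nat_neq_iff)
  qed
qed

lemma geometric_Ico_cover:
  assumes "c > (0::real)" "c \<le> t"
  obtains n where "t \<in> {c * 2 ^ n..<c * 2 ^ Suc n}"
proof -
  obtain m where "t / c < 2 ^ m" using real_arch_pow[of 2 "t / c"] by auto
  then have m: "t < c * 2 ^ m" using assms(1) by (simp add: field_simps)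
  define k where "k = (LEAST k. t < c * 2 ^ k)"
  have k: "t < c * 2 ^ k" unfolding k_def using m by (rule LeastI)
  with assms(2) obtain n where n: "k = Suc n" by (cases k) auto
  have "\<not> t < c * 2 ^ n" using not_less_Least[of n "\<lambda>k. t < c * 2 ^ k"] n k_def by auto
  then show ?thesis using k n by (intro that[of n]) auto
qed

text \<open>The interval of index \<open>n\<close> has length \<open>c * 2 ^ n\<close>, the source
  of the weights.\<close>

lemma nn_integral_geometric_step:
  assumes "c > (0::real)"
  shows "(\<integral>\<^sup>+t. (\<Sum>n. h n * indicator {c * 2 ^ n..<c * 2 ^ Suc n} t) \<partial>lborel) =
    ennreal c * (\<Sum>n. 2 ^ n * h n)"
proof -
  have "(\<integral>\<^sup>+t. (\<Sum>n. h n * indicator {c * 2 ^ n..<c * 2 ^ Suc n} t) \<partial>lborel) =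
      (\<Sum>n. h n * ennreal (c * 2 ^ Suc n - c * 2 ^ n))"
    using assms by (subst nn_integral_suminf) (auto simp: nn_integral_cmult_indicator)
  also have "\<dots> = (\<Sum>n. ennreal c * (2 ^ n * h n))"
    using assms
    by (intro suminf_cong) (simp add: ennreal_mult mult_ac flip: ennreal_power ennreal_numeral)
  finally show ?thesis by simp
qed

text \<open>Levels in \<open>{0..<\<tau>}\<close> use the crude bound \<open>h0\<close>; each later
  geometric interval uses its own \<open>h n\<close>.\<close>

lemma choquet_integral_le_geometric_levels:
  assumes "\<tau> > 0"
    and H0: "\<And>t. H {x \<in> B. g x > t} \<le> h0"
    and h: "\<And>n t. \<tau> * 2 ^ n \<le> t \<Longrightarrow> H {x \<in> B. g x > t} \<le> h n"
  shows "choquet_integral H B g \<le> ennreal \<tau> * (h0 + (\<Sum>n. 2 ^ n * h n))"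
proof -
  let ?s = "\<lambda>t. \<Sum>n. h n * indicator {\<tau> * 2 ^ n..<\<tau> * 2 ^ Suc n} t"
  have "choquet_integral H B g \<le> (\<integral>\<^sup>+t. h0 * indicator {0..<\<tau>} t + ?s t \<partial>lborel)"
    unfolding choquet_integral_def
  proof (intro nn_integral_mono)
    fix t :: real
    consider "t < 0" | "0 \<le> t" "t < \<tau>" | "\<tau> \<le> t" by linarith
    then show "H {x \<in> B. g x > t} * indicator {0..} t \<le> h0 * indicator {0..<\<tau>} t + ?s t"
    proof cases
      case 2
      then have "H {x \<in> B. g x > t} * indicator {0..} t \<le> h0 * indicator {0..<\<tau>} t"
        using H0[of t] by simp
      then show ?thesis by (rule order_trans) simp
    next
      case 3
      then obtain n where n: "t \<in> {\<tau> * 2 ^ n..<\<tau> * 2 ^ Suc n}"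
        using geometric_Ico_cover \<open>\<tau> > 0\<close> by blast
      then have "?s t = h n"
        by (intro suminf_cmult_indicator disjoint_family_geometric_Ico \<open>\<tau> > 0\<close>)
      moreover have "H {x \<in> B. g x > t} \<le> h n" using n by (intro h) auto
      ultimately show ?thesis using 3 \<open>\<tau> > 0\<close> by simp
    qed simp
  qed
  also have "\<dots> = h0 * ennreal \<tau> + (\<integral>\<^sup>+t. ?s t \<partial>lborel)"
    using \<open>\<tau> > 0\<close> by (subst nn_integral_add) (auto simp: nn_integral_cmult_indicator)
  also have "\<dots> = ennreal \<tau> * (h0 + (\<Sum>n. 2 ^ n * h n))"
    unfolding nn_integral_geometric_step[OF \<open>\<tau> > 0\<close>] by (simp add: distrib_left mult.commute)
  finally show ?thesis .
qed

text \<open>On each interval the level set at the right endpoint is the smallest, so the step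
  function lies below the integrand.\<close>

lemma geometric_levels_le_choquet_integral:
  assumes "c > 0" and mono: "\<And>A B. A \<subseteq> B \<Longrightarrow> H A \<le> H B"
  shows "ennreal c * (\<Sum>n. 2 ^ n * H {x. g x > c * 2 ^ Suc n}) \<le> choquet_integral H UNIV g"
proof -
  have "ennreal c * (\<Sum>n. 2 ^ n * H {x. g x > c * 2 ^ Suc n}) =
      (\<integral>\<^sup>+t. (\<Sum>n. H {x. g x > c * 2 ^ Suc n} * indicator {c * 2 ^ n..<c * 2 ^ Suc n} t) \<partial>lborel)"
    by (rule nn_integral_geometric_step[OF \<open>c > 0\<close>, symmetric])
  also have "\<dots> \<le> choquet_integral H UNIV g"
    unfolding choquet_integral_def
  proof (intro nn_integral_mono)
    fix t :: real
    let ?s = "\<Sum>n. H {x. g x > c * 2 ^ Suc n} * indicator {c * 2 ^ n..<c * 2 ^ Suc n} t"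
    show "?s \<le> H {x \<in> UNIV. g x > t} * indicator {0..} t"
    proof (cases "\<exists>n. t \<in> {c * 2 ^ n..<c * 2 ^ Suc n}")
      case True
      then obtain n where n: "t \<in> {c * 2 ^ n..<c * 2 ^ Suc n}" by blast
      then have "?s = H {x. g x > c * 2 ^ Suc n}"
        by (intro suminf_cmult_indicator disjoint_family_geometric_Ico \<open>c > 0\<close>)
      also have "\<dots> \<le> H {x \<in> UNIV. g x > t}" using n by (intro mono) auto
      also have "0 \<le> c * 2 ^ n" using \<open>c > 0\<close> by simp
      then have "0 \<le> t" using n by (simp del: power_Suc)
      then have "H {x \<in> UNIV. g x > t} = H {x \<in> UNIV. g x > t} * indicator {0..} t" by simp
      finally show ?thesis .
    next
      case False
      then have "?s = (\<Sum>n. 0)" by (intro suminf_cong) (auto simp del: power_Suc)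
      then show ?thesis by simp
    qed
  qed
  finally show ?thesis .
qed

text \<open>The tail is truncated in place, not shifted, so that its terms keep the index used for
  the levels.\<close>

lemma ennreal_suminf_tail_less:
  fixes g :: "nat \<Rightarrow> ennreal" and e :: real
  assumes "(\<Sum>n. g n) < \<infinity>" "e > 0"
  obtains K where "K \<ge> K0" "(\<Sum>n. if K \<le> n then g n else 0) < ennreal e"
proof -
  define h where "h n = enn2real (g n)" for n
  have "g n < \<infinity>" for n using ennreal_suminf_lessD[OF assms(1)] .
  then have gh: "g n = ennreal (h n)" for n by (simp add: h_def)
  have h0: "0 \<le> h n" for n by (simp add: h_def)
  have "summable h"
    using assms(1) h0 by (intro summable_suminf_not_top) (auto simp: gh)
  obtain N where N: "\<And>n. n \<ge> N \<Longrightarrow> norm (\<Sum>i. h (i + n)) < e"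
    using suminf_exist_split[OF assms(2) \<open>summable h\<close>] by blast
  define K where "K = max N K0"
  have "(\<lambda>i. h (i + K)) sums (\<Sum>i. h (i + K))"
    using \<open>summable h\<close> by (intro summable_sums summable_ignore_initial_segment)
  then have "(\<lambda>i. (if K \<le> i + K then h (i + K) else 0)) sums (\<Sum>i. h (i + K))"
    by simp
  then have "(\<lambda>n. if K \<le> n then h n else 0) sums (\<Sum>i. h (i + K))"
    by (subst (asm) sums_zero_iff_shift) auto
  then have "(\<Sum>n. ennreal (if K \<le> n then h n else 0)) = ennreal (\<Sum>i. h (i + K))"
    using h0 by (intro suminf_ennreal_eq) auto
  also have "\<dots> < ennreal e"
    using N[of K] assms(2) by (intro ennreal_lessI) (auto simp: K_def)
  also have "(\<Sum>n. ennreal (if K \<le> n then h n else 0)) = (\<Sum>n. if K \<le> n then g n else 0)"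
    by (intro suminf_cong) (simp add: gh)
  finally show ?thesis by (intro that[of K]) (simp_all add: K_def)
qed

section \<open>Comparison of balls with boxes and the oscillation estimate\<close>

text \<open>Take the floor of the binary logarithm of \<open>r / (N * l)\<close>. Since
  \<open>r < l\<close>, the quotient is below 1, which gives the scale bound of the weak type
  estimate.\<close>

lemma dyadic_scale_exists:
  fixes l N r :: real
  assumes "l > 0" "N \<ge> 1" "0 < r" "r < l"
  obtains k :: int where "k \<le> 0" "N * (2 powi k * l) \<le> r" "r < 2 * N * (2 powi k * l)"
proof -
  define q where "q = r / (N * l)"
  have "r < N * l" using assms mult_right_mono[of 1 N l] by linarith
  then have q: "0 < q" "q < 1" using assms by (simp_all add: q_def)
  define k where "k = \<lfloor>log 2 q\<rfloor>"
  have "2 powr k \<le> q" "q < 2 powr (k + 1)"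
    using q by (simp_all add: k_def flip: le_log_iff less_log_iff log_less_iff powr_le_iff)
  then have 1: "2 powi k \<le> q" "q < 2 * 2 powi k"
    by (simp_all add: powr_add powr_real_of_int')
  have "k \<le> 0" using q by (simp add: k_def floor_le_iff log_less_iff)
  moreover have "N * (2 powi k * l) \<le> r" "r < 2 * N * (2 powi k * l)"
    using 1 assms by (auto simp: q_def field_simps)
  ultimately show ?thesis by (rule that)
qed

text \<open>Coordinates differ by less than one side, and the Euclidean norm is at most the sum of
  the coordinates in absolute value; hence the factor \<open>CARD('n)\<close>.\<close>

lemma dyadic_box_subset_ball:
  fixes a x :: "real ^ 'n"
  assumes l: "l > 0" and r: "CARD('n) * (2 powi k * l) \<le> r"
  shows "dyadic_box a l k (dyadic_index a l k x) \<subseteq> ball x r"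
proof
  fix y assume y: "y \<in> dyadic_box a l k (dyadic_index a l k x)"
  have x: "x \<in> dyadic_box a l k (dyadic_index a l k x)" by (simp add: mem_dyadic_box_iff[OF l])
  define s where "s = 2 powi k * l"
  have "\<bar>(x - y) $ i\<bar> < s" for i
  proof -
    define m where "m = a $ i + s * of_int (dyadic_index a l k x $ i)"
    have "m \<le> y $ i" "y $ i < m + s" "m \<le> x $ i" "x $ i < m + s"
      using x y unfolding dyadic_box_def m_def s_def by (auto simp: algebra_simps)
    then show ?thesis by simp
  qed
  then have "(\<Sum>i\<in>UNIV. \<bar>(x - y) $ i\<bar>) < of_nat CARD('n) * s"
    by (intro sum_bounded_above_strict) auto
  then have "norm (x - y) < r"
    using norm_le_l1_cart[of "x - y"] r by (simp add: s_def)
  then show "y \<in> ball x r" by (simp add: dist_norm)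
qed

lemma ball_imp_dyadic_near:
  fixes a x y :: "real ^ 'n"
  assumes l: "l > 0" and r: "r < 2 * CARD('n) * (2 powi k * l)" and y: "y \<in> ball x r"
  shows "dyadic_near a l k y x"
  unfolding dyadic_near_def
proof
  fix i
  define s where "s = 2 powi k * l"
  have s: "s > 0" using l by (simp add: s_def)
  have "\<bar>(y - x) $ i\<bar> \<le> norm (y - x)" by (rule component_le_norm_cart)
  also have "\<dots> < 2 * CARD('n) * s" using y r by (simp add: dist_norm norm_minus_commute s_def)
  finally have "\<bar>(y $ i - a $ i) / s - (x $ i - a $ i) / s\<bar> < 2 * CARD('n)"
    using s by (simp add: diff_divide_distrib[symmetric] abs_divide divide_less_eq)
  then have "\<bar>\<lfloor>(y $ i - a $ i) / s\<rfloor> - \<lfloor>(x $ i - a $ i) / s\<rfloor>\<bar> \<le> 2 * int CARD('n)"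
    by linarith
  then show "\<bar>dyadic_index a l k y $ i - dyadic_index a l k x $ i\<bar> \<le> 2 * int CARD('n)"
    by (simp add: dyadic_index_def s_def)
qed

text \<open>Levels below \<open>\<tau>\<close> cost at most the whole ball. Higher levels live in
  \<open>U\<close> and are summed over the neighbouring boxes, each satisfying \<open>good\<close>
  and having content at most that of the ball.\<close>

lemma choquet_average_oscillation_le:
  fixes a x :: "real ^ 'n" and f :: "real ^ 'n \<Rightarrow> real"
  assumes l: "l > 0" and "mono \<phi>" and "\<tau> > 0" and "0 < r" "r < l"
    and fx: "\<bar>f x\<bar> \<le> M"
    and osc: "\<And>y. y \<in> ball x r \<Longrightarrow> y \<notin> U \<Longrightarrow> \<bar>f y - f x\<bar> \<le> \<tau>"
    and good: "\<And>k y. k \<le> 0 \<Longrightarrow> dyadic_near a l k x y \<Longrightarrow>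
      (\<Sum>n. 2 ^ n * dyadic_content a l \<phi>
        (dyadic_box a l k (dyadic_index a l k y) \<inter> {y \<in> U. \<tau> * 2 ^ n < \<bar>f y\<bar> + M})) \<le>
      dyadic_content a l \<phi> (dyadic_box a l k (dyadic_index a l k y))"
  shows "choquet_average (dyadic_content a l \<phi>) (ball x r) (\<lambda>y. \<bar>f y - f x\<bar>) \<le>
    ennreal (\<tau> * (1 + real (overlap_bound TYPE('n))))"
proof -
  let ?H = "dyadic_content a l \<phi>"
  let ?N = "of_nat (overlap_bound TYPE('n)) :: ennreal"
  define A where "A n = {y \<in> U. \<tau> * 2 ^ n < \<bar>f y\<bar> + M}" for n :: nat
  obtain k :: int where k: "k \<le> 0" "CARD('n) * (2 powi k * l) \<le> r" "r < 2 * CARD('n) * (2 powi k * l)"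
    using dyadic_scale_exists[of l "CARD('n)" r] l \<open>0 < r\<close> \<open>r < l\<close> by (auto simp: Suc_le_eq)
  define bx where "bx v = dyadic_box a l k (dyadic_index a l k x + v)" for v
  have box_le: "?H (bx v) \<le> ?H (ball x r)" for v
  proof -
    have "?H (bx v) = ?H (dyadic_box a l k (dyadic_index a l k x))"
      unfolding bx_def by (rule dyadic_content_box_translate[OF l \<open>mono \<phi>\<close>])
    also have "\<dots> \<le> ?H (ball x r)"
      by (intro dyadic_content_mono dyadic_box_subset_ball l k)
    finally show ?thesis .
  qed
  have sub: "ball x r \<subseteq> (\<Union>v\<in>near_offsets. bx v)"
    using dyadic_near_imp_box_offset[OF l ball_imp_dyadic_near[OF l k(3)]] unfolding bx_def by blast
  have "(\<Sum>n. 2 ^ n * ?H (ball x r \<inter> A n)) \<le> (\<Sum>n. \<Sum>v\<in>near_offsets. 2 ^ n * ?H (bx v \<inter> A n))"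
  proof (intro suminf_le summableI)
    fix n
    have "?H (ball x r \<inter> A n) \<le> ?H (\<Union>v\<in>near_offsets. bx v \<inter> A n)"
      using sub by (intro dyadic_content_mono) blast
    also have "\<dots> \<le> (\<Sum>v\<in>near_offsets. ?H (bx v \<inter> A n))"
      by (rule dyadic_content_UN_finite[OF finite_near_offsets])
    finally show "2 ^ n * ?H (ball x r \<inter> A n) \<le> (\<Sum>v\<in>near_offsets. 2 ^ n * ?H (bx v \<inter> A n))"
      unfolding sum_distrib_left[symmetric] by (intro mult_left_mono) auto
  qed
  also have "\<dots> = (\<Sum>v\<in>near_offsets. \<Sum>n. 2 ^ n * ?H (bx v \<inter> A n))"
    by (intro suminf_sum summableI)
  also have "\<dots> \<le> (\<Sum>v\<in>(near_offsets :: (int ^ 'n) set). ?H (ball x r))"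
  proof (intro sum_mono)
    fix v :: "int ^ 'n" assume v: "v \<in> near_offsets"
    \<comment> \<open>\<open>good\<close> speaks of boxes through their points, so the neighbour
      with offset \<open>v\<close> needs a representative.\<close>
    obtain z where z: "z \<in> bx v" using dyadic_box_nonempty[OF l] unfolding bx_def by blast
    then have idx: "dyadic_index a l k z = dyadic_index a l k x + v"
      by (simp add: bx_def mem_dyadic_box_iff[OF l])
    then have "dyadic_near a l k x z"
      using v by (simp add: dyadic_near_def near_offsets_def)
    then have "(\<Sum>n. 2 ^ n * ?H (bx v \<inter> A n)) \<le> ?H (bx v)"
      using good[OF k(1), of z] unfolding A_def bx_def idx by blast
    then show "(\<Sum>n. 2 ^ n * ?H (bx v \<inter> A n)) \<le> ?H (ball x r)"
      using box_le by (rule order_trans)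
  qed
  also have "\<dots> \<le> ?N * ?H (ball x r)"
    by (simp add: overlap_bound_def distrib_right)
  finally have levels: "(\<Sum>n. 2 ^ n * ?H (ball x r \<inter> A n)) \<le> ?N * ?H (ball x r)" .
  have "choquet_integral ?H (ball x r) (\<lambda>y. \<bar>f y - f x\<bar>) \<le>
      ennreal \<tau> * (?H (ball x r) + (\<Sum>n. 2 ^ n * ?H (ball x r \<inter> A n)))"
  proof (rule choquet_integral_le_geometric_levels[OF \<open>\<tau> > 0\<close>])
    fix n :: nat and t :: real
    assume t: "\<tau> * 2 ^ n \<le> t"
    have "\<tau> * 1 \<le> \<tau> * 2 ^ n" using \<open>\<tau> > 0\<close> by (intro mult_left_mono) auto
    show "?H {y \<in> ball x r. t < \<bar>f y - f x\<bar>} \<le> ?H (ball x r \<inter> A n)"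
    proof (intro dyadic_content_mono subsetI)
      fix y assume y: "y \<in> {y \<in> ball x r. t < \<bar>f y - f x\<bar>}"
      \<comment> \<open>Here \<open>t\<close> is at least \<open>\<tau>\<close>, which
        \<open>osc\<close> forbids outside \<open>U\<close>. The next step uses
        \<open>\<bar>f y - f x\<bar> \<le> \<bar>f y\<bar> + M\<close>.\<close>
      then have "y \<in> U" using osc[of y] t \<open>\<tau> * 1 \<le> \<tau> * 2 ^ n\<close> by fastforce
      then show "y \<in> ball x r \<inter> A n" using y t fx by (auto simp: A_def)
    qed
  qed (intro dyadic_content_mono, blast)
  also have "\<dots> \<le> ennreal \<tau> * (?H (ball x r) + ?N * ?H (ball x r))"
    by (intro mult_left_mono add_left_mono levels) simp
  also have "\<dots> = ennreal (\<tau> * (1 + real (overlap_bound TYPE('n)))) * ?H (ball x r)"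
  proof -
    have "ennreal (\<tau> * (1 + real (overlap_bound TYPE('n)))) = ennreal \<tau> * (1 + ?N)"
      using \<open>\<tau> > 0\<close> by (simp add: ennreal_mult ennreal_of_nat_eq_real_of_nat)
    then show ?thesis by (simp add: distrib_left distrib_right mult.assoc)
  qed
  finally have le: "choquet_integral ?H (ball x r) (\<lambda>y. \<bar>f y - f x\<bar>) \<le>
      ennreal (\<tau> * (1 + real (overlap_bound TYPE('n)))) * ?H (ball x r)" .
  show ?thesis
  proof (cases "?H (ball x r) = 0 \<or> ?H (ball x r) = \<infinity>")
    \<comment> \<open>Content 0 gives average 0 by definition; at infinite content the quotient is
      0.\<close>
    case True
    then show ?thesis by (auto simp: choquet_average_def ennreal_divide_top)
  next
    case False
    then show ?thesis
      using divide_right_mono_ennreal[OF le, of "?H (ball x r)"]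
      by (simp add: choquet_average_def ennreal_mult_divide_eq)
  qed
qed

section \<open>The exceptional sets have content zero\<close>

text \<open>The cutoff \<open>M\<close> allows one family of level sets to serve all points
  \<open>x\<close> at once. The set is caught in \<open>U \<union> Bad\<close>, of content at most
  any given \<open>e\<close>.\<close>

lemma dyadic_content_large_average_eq_0:
  fixes a :: "real ^ 'n" and f :: "real ^ 'n \<Rightarrow> real"
  assumes l: "l > 0" and "mono \<phi>" and f: "f \<in> choquet_L1 (dyadic_content a l \<phi>)"
    and "\<kappa> > 0"
  shows "dyadic_content a l \<phi> {x. \<bar>f x\<bar> \<le> M \<and>
    \<not> (\<forall>\<^sub>F r in at_right 0.
        choquet_average (dyadic_content a l \<phi>) (ball x r) (\<lambda>y. \<bar>f y - f x\<bar>) \<le> ennreal \<kappa>)} = 0"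
    (is "dyadic_content _ _ _ ?E = 0")
proof -
  let ?H = "dyadic_content a l \<phi>"
  define N where "N = real (overlap_bound TYPE('n))"
  have N: "N \<ge> 0" by (simp add: N_def)
  define \<tau> where "\<tau> = \<kappa> / (1 + N)"
  have \<tau>: "\<tau> > 0" "\<tau> * (1 + N) = \<kappa>" using N \<open>\<kappa> > 0\<close> by (auto simp: \<tau>_def)
  \<comment> \<open>The threshold equals \<open>\<tau> / 2 * 2 ^ n\<close>, half of the one in
    \<open>A n\<close>; the other half absorbs \<open>M\<close> once \<open>n\<close> is at least
    \<open>K0\<close>.\<close>
  define g where "g n = 2 ^ n * ?H {x. \<tau> / 4 * 2 ^ Suc n < \<bar>f x\<bar>}" for n :: nat
  have "ennreal (\<tau> / 4) * (\<Sum>n. g n) \<le> choquet_integral ?H UNIV (\<lambda>x. \<bar>f x\<bar>)"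
    unfolding g_def using \<tau>(1)
    by (intro geometric_levels_le_choquet_integral dyadic_content_mono) auto
  also have "\<dots> < \<infinity>" using f by (simp add: choquet_L1_def)
  finally have g: "(\<Sum>n. g n) < \<infinity>"
    using \<tau>(1) by (auto simp: ennreal_mult_less_top)
  obtain K0 where "M / (\<tau> / 2) < 2 ^ K0" using real_arch_pow[of 2] by auto
  then have K0: "M \<le> \<tau> / 2 * 2 ^ K0" using \<tau>(1) by (simp add: field_simps)
  have *: "?H ?E \<le> ennreal e" if "e > 0" for e
  proof -
    \<comment> \<open>\<open>U\<close> will contribute \<open>\<eta>\<close> and \<open>Bad\<close>
      will contribute \<open>4 * N * \<eta>\<close>, being \<open>2 * N\<close> times a level sum of
      at most \<open>2 * \<eta>\<close>.\<close>
    define \<eta> where "\<eta> = e / (1 + 4 * N)"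
    have "\<eta> * (1 + 4 * N) = e" using N by (simp add: \<eta>_def)
    then have \<eta>: "\<eta> > 0" "\<eta> + 4 * N * \<eta> = e"
      using N \<open>e > 0\<close> by (simp add: \<eta>_def, simp add: algebra_simps)
    obtain K where K: "K0 \<le> K" "(\<Sum>n. if K \<le> n then g n else 0) < ennreal \<eta>"
      using ennreal_suminf_tail_less[OF g \<eta>(1)] by blast
    \<comment> \<open>The index \<open>K\<close> depends on \<open>f\<close> and not on
      \<open>U\<close>, so \<open>U\<close> may be chosen after it. The factor \<open>4 ^ K\<close>
      makes \<open>2 ^ n * \<delta> \<le> \<eta> * (1/2) ^ Suc n\<close> for all
      \<open>n < K\<close>.\<close>
    define \<delta> where "\<delta> = \<eta> / (2 * 4 ^ K)"
    have \<delta>: "\<delta> > 0" "\<delta> \<le> \<eta>" using \<eta>(1) by (auto simp: \<delta>_def field_simps intro: order_trans[of 1 "4 ^ K"])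
    obtain U where U: "open U" "?H U < ennreal \<delta>" "continuous_on (- U) f"
      using f \<delta>(1) unfolding choquet_L1_def quasicontinuous_def by blast
    define A where "A n = {y \<in> U. \<tau> * 2 ^ n < \<bar>f y\<bar> + M}" for n :: nat
    define Bad where "Bad = {x. \<exists>k y. k \<le> 0 \<and> dyadic_near a l k x y \<and>
          ?H (dyadic_box a l k (dyadic_index a l k y)) <
          (\<Sum>n. 2 ^ n * ?H (dyadic_box a l k (dyadic_index a l k y) \<inter> A n))}"
    \<comment> \<open>High levels are controlled by the tail for \<open>f\<close>, low levels by the
      small content of \<open>U\<close>.\<close>
    have level: "2 ^ n * ?H (A n) \<le> ennreal (\<eta> * (1/2) ^ Suc n) + (if K \<le> n then g n else 0)" for n
    proof (cases "K \<le> n")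
      case True
      have "M \<le> \<tau> / 2 * 2 ^ n"
        using K0 True K(1) \<tau>(1)
        by (elim order_trans) (intro mult_left_mono power_increasing, auto)
      then have "A n \<subseteq> {x. \<tau> / 4 * 2 ^ Suc n < \<bar>f x\<bar>}"
        by (auto simp: A_def)
      then have "2 ^ n * ?H (A n) \<le> g n"
        unfolding g_def by (intro mult_left_mono dyadic_content_mono) auto
      then show ?thesis using True by (simp add: add_increasing)
    next
      case False
      have "?H (A n) \<le> ?H U" by (intro dyadic_content_mono) (auto simp: A_def)
      then have "2 ^ n * ?H (A n) \<le> 2 ^ n * ennreal \<delta>"
        using U(2) by (intro mult_left_mono) auto
      also have "\<dots> = ennreal (2 ^ n * \<delta>)"
        using \<delta>(1) by (simp add: ennreal_mult flip: ennreal_power ennreal_numeral)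
      also have "\<dots> \<le> ennreal (\<eta> * (1/2) ^ Suc n)"
      proof (rule ennreal_leI)
        have "(4::real) ^ n \<le> 4 ^ K" using False by (intro power_increasing) auto
        then have "\<delta> \<le> \<eta> / (2 * 4 ^ n)"
          unfolding \<delta>_def using \<eta>(1) by (intro divide_left_mono) auto
        then have "2 ^ n * \<delta> \<le> 2 ^ n * (\<eta> / (2 * 4 ^ n))" by (intro mult_left_mono) auto
        also have "(4::real) ^ n = 2 ^ n * 2 ^ n" by (simp flip: power_mult_distrib)
        finally show "2 ^ n * \<delta> \<le> \<eta> * (1/2) ^ Suc n" by (simp add: field_simps)
      qed
      finally show ?thesis using False by simp
    qed
    have "(\<Sum>n. 2 ^ n * ?H (A n)) \<le>
        (\<Sum>n. ennreal (\<eta> * (1/2) ^ Suc n) + (if K \<le> n then g n else 0))"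
      by (intro suminf_le summableI level)
    also have "\<dots> = ennreal \<eta> + (\<Sum>n. if K \<le> n then g n else 0)"
      using \<eta>(1) by (subst suminf_add[OF summableI summableI, symmetric])
        (subst ennreal_suminf_geometric_half, simp_all del: power_Suc)
    also have "\<dots> \<le> ennreal \<eta> + ennreal \<eta>" using K(2) by (intro add_left_mono) auto
    also have "\<dots> = ennreal (2 * \<eta>)" using \<eta>(1) by (simp flip: ennreal_plus)
    finally have T: "(\<Sum>n. 2 ^ n * ?H (A n)) \<le> ennreal (2 * \<eta>)" .
    \<comment> \<open>Off \<open>U\<close>, relative continuity bounds the oscillation; off
      \<open>Bad\<close>, every nearby box is good. Radii below \<open>min d l\<close> satisfy both
      requirements on \<open>r\<close>.\<close>
    have "?E \<subseteq> U \<union> Bad"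
    proof
      fix x assume "x \<in> ?E"
      then have fx: "\<bar>f x\<bar> \<le> M" and large: "\<not> (\<forall>\<^sub>F r in at_right 0.
        choquet_average ?H (ball x r) (\<lambda>y. \<bar>f y - f x\<bar>) \<le> ennreal \<kappa>)" by auto
      show "x \<in> U \<union> Bad"
      proof (rule ccontr)
        assume "x \<notin> U \<union> Bad"
        then have x: "x \<in> - U" "x \<notin> Bad" by auto
        obtain d where d: "d > 0" "\<And>y. y \<in> - U \<Longrightarrow> dist y x < d \<Longrightarrow> dist (f y) (f x) < \<tau>"
          using U(3) x(1) \<tau>(1) unfolding continuous_on_iff by blast
        have "choquet_average ?H (ball x r) (\<lambda>y. \<bar>f y - f x\<bar>) \<le> ennreal \<kappa>"
          if r: "0 < r" "r < min d l" for r
          unfolding \<tau>(2)[symmetric] N_def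
        proof (rule choquet_average_oscillation_le[OF l \<open>mono \<phi>\<close> \<tau>(1), where M = M and U = U])
          show "\<bar>f y - f x\<bar> \<le> \<tau>" if "y \<in> ball x r" "y \<notin> U" for y
            using d(2)[of y] that r by (simp add: dist_commute dist_real_def)
        qed (use r fx x(2) in \<open>auto simp: Bad_def A_def not_less\<close>)
        then have "\<forall>\<^sub>F r in at_right 0. choquet_average ?H (ball x r) (\<lambda>y. \<bar>f y - f x\<bar>) \<le> ennreal \<kappa>"
          unfolding eventually_at_right_field using d(1) l by (intro exI[of _ "min d l"]) auto
        with large show False by contradiction
      qed
    qed
    then have "?H ?E \<le> ?H U + ?H Bad"
      by (rule order_trans[OF dyadic_content_mono dyadic_content_Un])
    also have "?H Bad \<le> 2 * of_nat (overlap_bound TYPE('n)) * (\<Sum>n. 2 ^ n * ?H (A n))"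
      unfolding Bad_def by (rule dyadic_content_bad_boxes_le[OF l \<open>mono \<phi>\<close>])
    also have "\<dots> \<le> 2 * of_nat (overlap_bound TYPE('n)) * ennreal (2 * \<eta>)"
      by (intro mult_left_mono T) simp
    also have "\<dots> = ennreal (4 * N * \<eta>)"
      using N \<eta>(1) by (simp add: N_def ennreal_of_nat_eq_real_of_nat mult_ac
        flip: ennreal_mult ennreal_numeral)
    also have "?H U \<le> ennreal \<eta>" using U(2) ennreal_leI[OF \<delta>(2)] by simp
    also have "ennreal \<eta> + ennreal (4 * N * \<eta>) = ennreal e"
      using N \<eta> by (simp flip: ennreal_plus)
    finally show "?H ?E \<le> ennreal e" by (simp add: add_mono)
  qed
  have "?H ?E \<le> 0" by (rule ennreal_le_epsilon) (simp add: *)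
  then show ?thesis by simp
qed

theorem theorem2:
  fixes a :: "real ^ 'n" and l :: real
    and \<phi> :: "ennreal \<Rightarrow> ennreal" and f :: "real ^ 'n \<Rightarrow> real"
  assumes "l > 0"
    and "mono \<phi>"
    and "(\<phi> \<longlongrightarrow> 0) (at_right 0)"
    and "f \<in> choquet_L1 (dyadic_content a l \<phi>)"
  shows "quasi_every (dyadic_content a l \<phi>)
    (\<lambda>x. ((\<lambda>r. choquet_average (dyadic_content a l \<phi>) (ball x r) (\<lambda>y. \<bar>f y - f x\<bar>))
            \<longlongrightarrow> 0) (at_right 0))"
proof -
  let ?H = "dyadic_content a l \<phi>"
  let ?avg = "\<lambda>x r. choquet_average ?H (ball x r) (\<lambda>y. \<bar>f y - f x\<bar>)"
  \<comment> \<open>One counter serves as bound for \<open>\<bar>f x\<bar>\<close> and as precision,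
    so countably many null sets suffice.\<close>
  define E where "E n = {x. \<bar>f x\<bar> \<le> real n \<and>
    \<not> (\<forall>\<^sub>F r in at_right 0. ?avg x r \<le> ennreal (1 / real (Suc n)))}" for n
  have "?H (E n) = 0" for n
    unfolding E_def using assms by (intro dyadic_content_large_average_eq_0) auto
  then have "?H (\<Union>n. E n) = 0"
    using dyadic_content_UN_nat[of a l \<phi> E] by simp
  moreover have "(?avg x \<longlongrightarrow> 0) (at_right 0)" if x: "x \<notin> (\<Union>n. E n)" for x
  proof (rule order_tendstoI)
    fix c :: ennreal assume "0 < c"
    then obtain b where b: "0 < b" "b < c" using dense by blast
    then obtain d where d: "b = ennreal d" "d > 0" by (cases b) auto
    obtain n where n: "max \<bar>f x\<bar> (1 / d) < real n" using reals_Archimedean2 by blast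
    have "1 / real (Suc n) \<le> d" using n d(2) by (simp add: field_simps)
    then have "ennreal (1 / real (Suc n)) < c" using b d(1) ennreal_leI le_less_trans by metis
    moreover have "\<forall>\<^sub>F r in at_right 0. ?avg x r \<le> ennreal (1 / real (Suc n))"
      using x n by (auto simp: E_def)
    ultimately show "\<forall>\<^sub>F r in at_right 0. ?avg x r < c"
      by (elim eventually_mono) (rule le_less_trans)
  qed simp
  ultimately show ?thesis unfolding quasi_every_def by blast
qed

end
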